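(* Let $G=(V,E)$ be a finite simple undirected graph, let $r$ be a positive integer, and let $\mathrm{exp}(G,r)$ be the $r$-expansion of $G$. Then $$N^{(i)}(\mathrm{exp}(G,r),x)=N^{(i)}\bigl(G,(1+x)^{r}-1\bigr),$$ where the right-hand side is the polynomial $N^{(i)}(G,\cdot)$ evaluated at $(1+x)^r-1$.
   Context: For a finite simple undirected graph $G=(V,E)$ and $v\in V$, the open neighborhood of $v$ is $N(v)=\{u \mid \{u,v\}\in E\}$. The independent neighborhood polynomial of a graph $G$ of order $n$ is $N^{(i)}(G,x)=\sum_{k=0}^{n} n_k^{(i)}(G)x^k$, where $n_k^{(i)}(G)$ is the number of independent vertex subsets $A\subseteq V$ with $|A|=k$ for which there exists $v\in V$ with $A\subseteq N(v)$ (the empty set is independent and is counted). For a positive integer $r$, the $r$-expansion $\mathrm{exp}(G,r)$ of $G$ is the graph obtained from $G$ by replacing every vertex $v\in V$ with an independent set $I_v$ of size $r$ (these sets being pairwise disjoint) and replacing every edge $\{u,v\}\in E$ with a complete bipartite graph $K_{r,r}$ with bipartition sets $I_u$ and $I_v$. *)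

theory Defs
  imports "HOL-Computational_Algebra.Polynomial"
begin

record 'a ugraph =
  verts :: "'a set"
  edges :: "'a set set"

definition finite_simple_graph :: "'a ugraph \<Rightarrow> bool" where
  "finite_simple_graph G \<longleftrightarrow>
     finite (verts G) \<and> (\<forall>e\<in>edges G. e \<subseteq> verts G \<and> card e = 2)"

definition nbhd :: "'a ugraph \<Rightarrow> 'a \<Rightarrow> 'a set" where
  "nbhd G v = {u. {u, v} \<in> edges G}"

definition independent_set :: "'a ugraph \<Rightarrow> 'a set \<Rightarrow> bool" where
  "independent_set G A \<longleftrightarrow>
     A \<subseteq> verts G \<and> (\<forall>u\<in>A. \<forall>v\<in>A. {u, v} \<notin> edges G)"

definition indep_nbhd_count :: "'a ugraph \<Rightarrow> nat \<Rightarrow> nat" where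
  "indep_nbhd_count G k =
     card {A. independent_set G A \<and> card A = k \<and> (\<exists>v\<in>verts G. A \<subseteq> nbhd G v)}"

definition indep_nbhd_poly :: "'a ugraph \<Rightarrow> int poly" where
  "indep_nbhd_poly G =
     (\<Sum>k\<le>card (verts G). monom (int (indep_nbhd_count G k)) k)"

(* The independent set replacing the vertex v is {v} \<times> {..<r}. *)
definition expansion :: "'a ugraph \<Rightarrow> nat \<Rightarrow> ('a \<times> nat) ugraph" where
  "expansion G r =
     \<lparr>verts = verts G \<times> {..<r},
      edges = {{(u, i), (v, j)} | u v i j. {u, v} \<in> edges G \<and> i < r \<and> j < r}\<rparr>"

end

theory Submission
  imports Defs "HOL-Library.FuncSet"
begin

text \<open>
  Write \<open>F(G)\<close> for the family of independent vertex sets of \<open>G\<close> that lie in some neighborhood, so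
  that the polynomial of \<open>G\<close> is \<open>\<Sum>A\<in>F(G). x ^ card A\<close>. For a vertex set \<open>B\<close> of the expansion, both
  independence and having a common neighbor depend only on the projection \<open>fst ` B\<close>: copies of \<open>u\<close>
  and \<open>v\<close> are adjacent exactly if \<open>u\<close> and \<open>v\<close> are, and every vertex \<open>v\<close> has at least one copy because
  \<open>r > 0\<close>. Hence \<open>F\<close> of the expansion is the disjoint union, over \<open>A \<in> F(G)\<close>, of the families of sets
  \<open>B\<close> that project onto \<open>A\<close> (lemma \<open>indep_nbhd_family_expansion\<close>).

  A set \<open>B\<close> projects onto \<open>A\<close> if and only if it arises by choosing, independently for each \<open>a \<in> A\<close>, a
  nonempty set of the \<open>r\<close> copies of \<open>a\<close>. One such choice contributes \<open>(1 + x) ^ r - 1\<close>, so all the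
  sets above \<open>A\<close> together contribute \<open>((1 + x) ^ r - 1) ^ card A\<close> (lemma
  \<open>sum_power_card_projecting_onto\<close>). This is the term of \<open>A\<close> in the polynomial of \<open>G\<close> after
  substituting \<open>(1 + x) ^ r - 1\<close> for \<open>x\<close>.
\<close>

lemma sum_power_card_Pow:
  fixes x :: "'b::comm_semiring_1"
  assumes "finite R"
  shows "(\<Sum>S\<in>Pow R. x ^ card S) = (1 + x) ^ card R"
  using assms
proof (induction R)
  case (insert a R)
  have "inj_on (insert a) (Pow R)"
    using insert.hyps by (auto simp: inj_on_def)
  moreover have "card (insert a S) = Suc (card S)" if "S \<in> Pow R" for S
    using insert.hyps that by (auto intro!: card_insert_disjoint dest: finite_subset)
  ultimately have "(\<Sum>S\<in>insert a ` Pow R. x ^ card S) = x * (\<Sum>S\<in>Pow R. x ^ card S)"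
    by (simp add: sum.reindex sum_distrib_left)
  moreover have "Pow R \<inter> insert a ` Pow R = {}"
    using insert.hyps by auto
  ultimately show ?case
    using insert by (simp add: Pow_insert sum.union_disjoint algebra_simps)
qed simp

text \<open>
  A set with projection \<open>A\<close> is the same thing as its family of fibers, a function from \<open>A\<close> to the
  nonempty subsets of \<open>R\<close>; the sum over all such functions factors into one factor per element of \<open>A\<close>.
\<close>

lemma sum_power_card_projecting_onto:
  fixes x :: "'b::comm_ring_1"
  assumes "finite A" "finite R"
  shows "(\<Sum>B\<in>{B. B \<subseteq> A \<times> R \<and> fst ` B = A}. x ^ card B) = ((1 + x) ^ card R - 1) ^ card A"
proof -
  define P where "P = Pow R - {{}}"
  have "(\<Sum>B\<in>{B. B \<subseteq> A \<times> R \<and> fst ` B = A}. x ^ card B)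
      = (\<Sum>f\<in>A \<rightarrow>\<^sub>E P. \<Prod>a\<in>A. x ^ card (f a))"
  proof (rule sum.reindex_bij_witness
      [where j = "\<lambda>B. \<lambda>a\<in>A. {i. (a, i) \<in> B}" and i = "\<lambda>f. Sigma A f"])
    fix B assume B: "B \<in> {B. B \<subseteq> A \<times> R \<and> fst ` B = A}"
    show Sigma_fibers: "Sigma A (\<lambda>a\<in>A. {i. (a, i) \<in> B}) = B"
      using B by (force split: if_splits)
    show "(\<lambda>a\<in>A. {i. (a, i) \<in> B}) \<in> A \<rightarrow>\<^sub>E P"
      using B by (force simp: P_def)
    then have "\<forall>a\<in>A. finite ((\<lambda>a\<in>A. {i. (a, i) \<in> B}) a)"
      using \<open>finite R\<close> by (auto simp: P_def dest!: PiE_mem intro: finite_subset)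
    then have "card (Sigma A (\<lambda>a\<in>A. {i. (a, i) \<in> B}))
        = (\<Sum>a\<in>A. card ((\<lambda>a\<in>A. {i. (a, i) \<in> B}) a))"
      using \<open>finite A\<close> by (intro card_SigmaI)
    then show "(\<Prod>a\<in>A. x ^ card ((\<lambda>a\<in>A. {i. (a, i) \<in> B}) a)) = x ^ card B"
      by (simp only: Sigma_fibers power_sum)
  next
    fix f assume f: "f \<in> A \<rightarrow>\<^sub>E P"
    show "(\<lambda>a\<in>A. {i. (a, i) \<in> Sigma A f}) = f"
      using f by (auto simp: fun_eq_iff PiE_def extensional_def restrict_def)
    have "f a \<subseteq> R \<and> f a \<noteq> {}" if "a \<in> A" for a
      using f that by (auto simp: P_def)
    then show "Sigma A f \<in> {B. B \<subseteq> A \<times> R \<and> fst ` B = A}"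
      by (auto simp: image_iff) blast+
  qed
  also have "\<dots> = (\<Prod>a\<in>A. \<Sum>S\<in>P. x ^ card S)"
    using assms by (subst prod_sum_PiE) (auto simp: P_def)
  also have "(\<Sum>S\<in>P. x ^ card S) = (1 + x) ^ card R - 1"
    using \<open>finite R\<close> by (simp add: P_def sum_diff sum_power_card_Pow)
  finally show ?thesis
    by simp
qed

definition indep_nbhd_family :: "'a ugraph \<Rightarrow> 'a set set" where
  "indep_nbhd_family G = {A. independent_set G A \<and> (\<exists>v\<in>verts G. A \<subseteq> nbhd G v)}"

lemma finite_indep_nbhd_family:
  assumes "finite (verts G)"
  shows "finite (indep_nbhd_family G)"
  by (rule finite_subset[of _ "Pow (verts G)"])
    (use assms in \<open>auto simp: indep_nbhd_family_def independent_set_def\<close>)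

text \<open>
  Summing over the sets themselves, rather than over their cardinalities, makes it possible to
  regroup the sum for the expansion by the projections of the sets.
\<close>

lemma indep_nbhd_poly_eq_sum:
  assumes "finite (verts G)"
  shows "indep_nbhd_poly G = (\<Sum>A\<in>indep_nbhd_family G. [:0, 1:] ^ card A)"
proof -
  have "(\<Sum>A\<in>indep_nbhd_family G. [:0, 1:] ^ card A :: int poly)
      = (\<Sum>k\<le>card (verts G). \<Sum>A\<in>{A \<in> indep_nbhd_family G. card A = k}. [:0, 1:] ^ card A)"
    using assms
    by (intro sum.group[symmetric] finite_indep_nbhd_family)
      (auto simp: indep_nbhd_family_def independent_set_def card_mono)
  also have "\<dots> = (\<Sum>k\<le>card (verts G). monom (int (indep_nbhd_count G k)) k)"
  proof (rule sum.cong[OF refl])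
    fix k
    have "{A \<in> indep_nbhd_family G. card A = k}
        = {A. independent_set G A \<and> card A = k \<and> (\<exists>v\<in>verts G. A \<subseteq> nbhd G v)}"
      by (auto simp: indep_nbhd_family_def)
    then show "(\<Sum>A\<in>{A \<in> indep_nbhd_family G. card A = k}. [:0, 1:] ^ card A)
        = monom (int (indep_nbhd_count G k)) k"
      by (simp add: indep_nbhd_count_def monom_altdef of_nat_poly)
  qed
  finally show ?thesis
    by (simp add: indep_nbhd_poly_def)
qed

lemma pcompose_power:
  fixes p q :: "'b::comm_semiring_1 poly"
  shows "pcompose (p ^ n) q = pcompose p q ^ n"
  by (induction n) (simp_all add: pcompose_mult pcompose_1)

lemma edge_expansion_iff:
  "{(u, i), (v, j)} \<in> edges (expansion G r) \<longleftrightarrow> {u, v} \<in> edges G \<and> i < r \<and> j < r"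
  by (auto simp: expansion_def doubleton_eq_iff insert_commute)

text \<open>
  A vertex \<open>v\<close> whose neighborhood contains \<open>fst ` B\<close> gives the common neighbor \<open>(v, 0)\<close> of \<open>B\<close>,
  which is a vertex of the expansion because \<open>r > 0\<close>.
\<close>

lemma indep_nbhd_family_expansion:
  assumes "r > 0"
  shows "B \<in> indep_nbhd_family (expansion G r)
    \<longleftrightarrow> B \<subseteq> verts G \<times> {..<r} \<and> fst ` B \<in> indep_nbhd_family G"
proof (cases "B \<subseteq> verts G \<times> {..<r}")
  case True
  then have less: "i < r" if "(u, i) \<in> B" for u i
    using that by auto
  have verts: "verts (expansion G r) = verts G \<times> {..<r}"
    by (simp add: expansion_def)
  have "independent_set (expansion G r) B \<longleftrightarrow> independent_set G (fst ` B)"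
    using True less unfolding independent_set_def
    by (force simp: edge_expansion_iff verts)
  moreover have "B \<subseteq> nbhd (expansion G r) (v, j) \<longleftrightarrow> fst ` B \<subseteq> nbhd G v" if "j < r" for v j
    using less that by (force simp: nbhd_def edge_expansion_iff)
  ultimately show ?thesis
    using True assms by (auto simp: indep_nbhd_family_def verts)
next
  case False
  then show ?thesis
    by (auto simp: indep_nbhd_family_def independent_set_def expansion_def)
qed

theorem theorem4:
  fixes G :: "'a ugraph" and r :: nat
  assumes "finite_simple_graph G"
    and "r > 0"
  shows "indep_nbhd_poly (expansion G r) = pcompose (indep_nbhd_poly G) ([:1, 1:] ^ r - 1)"
proof -
  let ?F = "indep_nbhd_family G" and ?F' = "indep_nbhd_family (expansion G r)"
  have fin: "finite (verts G)"
    using assms by (simp add: finite_simple_graph_def)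
  then have fin': "finite (verts (expansion G r))"
    by (simp add: expansion_def)
  have fiber: "(\<Sum>B\<in>{B \<in> ?F'. fst ` B = A}. [:0, 1:] ^ card B) = ([:1, 1:] ^ r - 1 :: int poly) ^ card A"
    if A: "A \<in> ?F" for A
  proof -
    have sub: "A \<subseteq> verts G"
      using A by (simp add: indep_nbhd_family_def independent_set_def)
    have "{B \<in> ?F'. fst ` B = A} = {B. B \<subseteq> A \<times> {..<r} \<and> fst ` B = A}"
      using A sub by (force simp: indep_nbhd_family_expansion[OF \<open>r > 0\<close>])
    moreover have "1 + [:0, 1:] = ([:1, 1:] :: int poly)"
      by (simp add: one_pCons)
    ultimately show ?thesis
      using sum_power_card_projecting_onto[of A "{..<r}" "[:0, 1:] :: int poly"]
        finite_subset[OF sub fin] by simp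
  qed
  have "indep_nbhd_poly (expansion G r)
      = (\<Sum>A\<in>?F. \<Sum>B\<in>{B \<in> ?F'. fst ` B = A}. [:0, 1:] ^ card B)"
    unfolding indep_nbhd_poly_eq_sum[OF fin']
    by (intro sum.group[symmetric] finite_indep_nbhd_family fin fin')
      (auto simp: indep_nbhd_family_expansion[OF \<open>r > 0\<close>])
  also have "\<dots> = (\<Sum>A\<in>?F. ([:1, 1:] ^ r - 1) ^ card A)"
    by (simp add: fiber)
  also have "\<dots> = pcompose (indep_nbhd_poly G) ([:1, 1:] ^ r - 1)"
    by (simp add: indep_nbhd_poly_eq_sum[OF fin] pcompose_sum pcompose_power pcompose_pCons)
  finally show ?thesis .
qed

end
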